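(* The class of MI-lattices is closed under linear sums: if $P$ and $Q$ are disjoint finite MI-lattices, then their linear sum is an MI-lattice.
   Context: The linear (ordinal) sum of disjoint ordered sets $P$ and $Q$ is the order on $P\cup Q$ whose restrictions to $P$ and $Q$ are the given orders and in which every element of $P$ is below every element of $Q$. An MI-ordering of an antichain $\mathcal{A}$ in a lattice $L$ is a listing $a_1,\ldots,a_t$ of the elements of $\mathcal{A}$ such that (i) $a_i\lor a_{i+1}\lor\cdots\lor a_k=a_i\lor a_k$ for all $1\le i<k\le t$, and (ii) $(a_1\land\cdots\land a_k)\lor a_{k+1}=a_k\lor a_{k+1}$ for all $1<k<t$. An MI-lattice is a lattice all of whose antichains have an MI-ordering. *)

theory Defs
  imports "HOL-Algebra.Lattice"
begin

definition antichain_in :: "('a, 'b) gorder_scheme \<Rightarrow> 'a set \<Rightarrow> bool" where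
  "antichain_in L A \<longleftrightarrow>
     A \<subseteq> carrier L \<and> (\<forall>x\<in>A. \<forall>y\<in>A. x \<sqsubseteq>\<^bsub>L\<^esub> y \<longrightarrow> x = y)"

text \<open>The listing is the family \<open>a 1, \<dots>, a t\<close>; the iterated joins and meets
  over a nonempty index range are the supremum and infimum in \<open>L\<close> of its members.\<close>

definition MI_ordering ::
    "('a, 'b) gorder_scheme \<Rightarrow> 'a set \<Rightarrow> nat \<Rightarrow> (nat \<Rightarrow> 'a) \<Rightarrow> bool" where
  "MI_ordering L A t a \<longleftrightarrow>
     bij_betw a {1..t} A \<and>
     (\<forall>i k. 1 \<le> i \<and> i < k \<and> k \<le> t \<longrightarrow>
        \<Squnion>\<^bsub>L\<^esub>(a ` {i..k}) = a i \<squnion>\<^bsub>L\<^esub> a k) \<and>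
     (\<forall>k. 1 < k \<and> k < t \<longrightarrow>
        (\<Sqinter>\<^bsub>L\<^esub>(a ` {1..k})) \<squnion>\<^bsub>L\<^esub> a (k + 1) = a k \<squnion>\<^bsub>L\<^esub> a (k + 1))"

definition MI_lattice :: "('a, 'b) gorder_scheme \<Rightarrow> bool" where
  "MI_lattice L \<longleftrightarrow>
     lattice L \<and> (\<forall>A. antichain_in L A \<longrightarrow> (\<exists>t a. MI_ordering L A t a))"

text \<open>Meaningful only for disjoint carriers.\<close>

definition linear_sum ::
    "('a, 'b) gorder_scheme \<Rightarrow> ('a, 'c) gorder_scheme \<Rightarrow> 'a gorder" where
  "linear_sum P Q =
     \<lparr>carrier = carrier P \<union> carrier Q,
      eq = (=),
      le = (\<lambda>x y. (x \<in> carrier P \<and> y \<in> carrier P \<and> x \<sqsubseteq>\<^bsub>P\<^esub> y) \<or>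
                  (x \<in> carrier Q \<and> y \<in> carrier Q \<and> x \<sqsubseteq>\<^bsub>Q\<^esub> y) \<or>
                  (x \<in> carrier P \<and> y \<in> carrier Q))\<rparr>"

end

theory Submission
  imports Defs
begin

text \<open>An element of \<open>P\<close> and an element of \<open>Q\<close> are always comparable in the linear sum, so an
  antichain lies entirely in one summand. Suprema and infima of finite nonempty subsets of a summand
  are unchanged in the sum, so an MI-ordering in the summand remains one in the sum.\<close>

text \<open>\<open>sup\<close> is a Hilbert choice among least upper bounds. A least element is
  unique up to equality in a partial order, so exhibiting one determines the choice; the dual below
  rests on the same argument.\<close>

lemma (in partial_order) sup_eqI: "least L s (Upper L A) \<Longrightarrow> \<Squnion>A = s"
  unfolding sup_def by (rule some_equality) (auto intro: least_unique)

lemma (in partial_order) inf_eqI: "greatest L s (Lower L A) \<Longrightarrow> \<Sqinter>A = s"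
  unfolding inf_def by (rule some_equality) (auto intro: greatest_unique)

text \<open>All joins and meets in \<open>MI_ordering\<close> are taken over finite nonempty subsets
  of \<open>carrier K\<close>, so it suffices that bounds of such sets agree in \<open>K\<close> and
  \<open>L\<close>. Phrasing this with \<open>least\<close> and \<open>greatest\<close> lets both
  summands be treated alike, each as an instance of \<open>K\<close>.\<close>

lemma MI_ordering_transfer:
  assumes K: "lattice K" and L: "partial_order L"
    and least: "\<And>X s. \<lbrakk>X \<subseteq> carrier K; X \<noteq> {}; least K s (Upper K X)\<rbrakk> \<Longrightarrow> least L s (Upper L X)"
    and greatest: "\<And>X s. \<lbrakk>X \<subseteq> carrier K; X \<noteq> {}; greatest K s (Lower K X)\<rbrakk>
                     \<Longrightarrow> greatest L s (Lower L X)"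
    and A: "A \<subseteq> carrier K" and MI: "MI_ordering K A t a"
  shows "MI_ordering L A t a"
proof -
  interpret K: lattice K by (rule K)
  interpret L: partial_order L by (rule L)
  \<comment> \<open>In the lattice \<open>K\<close> a finite nonempty set really has a least upper
    bound. The assumption carries it to \<open>L\<close>, where \<open>sup_eqI\<close> identifies it
    with the chosen supremum.\<close>
  have sup: "\<Squnion>\<^bsub>L\<^esub>X = \<Squnion>\<^bsub>K\<^esub>X" if "finite X" "X \<subseteq> carrier K" "X \<noteq> {}" for X
    using that by (intro L.sup_eqI least K.finite_sup_least)
  have inf: "\<Sqinter>\<^bsub>L\<^esub>X = \<Sqinter>\<^bsub>K\<^esub>X" if "finite X" "X \<subseteq> carrier K" "X \<noteq> {}" for X
    using that by (intro L.inf_eqI greatest K.finite_inf_greatest)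
  have join: "x \<squnion>\<^bsub>L\<^esub> y = x \<squnion>\<^bsub>K\<^esub> y" if "x \<in> carrier K" "y \<in> carrier K" for x y
    using that by (simp add: join_def sup)
  have bij: "bij_betw a {1..t} A"
    and joins: "\<And>i k. \<lbrakk>1 \<le> i; i < k; k \<le> t\<rbrakk> \<Longrightarrow> \<Squnion>\<^bsub>K\<^esub>(a ` {i..k}) = a i \<squnion>\<^bsub>K\<^esub> a k"
    and meets: "\<And>k. \<lbrakk>1 < k; k < t\<rbrakk> \<Longrightarrow>
                  (\<Sqinter>\<^bsub>K\<^esub>(a ` {1..k})) \<squnion>\<^bsub>K\<^esub> a (k + 1) = a k \<squnion>\<^bsub>K\<^esub> a (k + 1)"
    using MI unfolding MI_ordering_def by blast+
  have mem: "a i \<in> carrier K" if "1 \<le> i" "i \<le> t" for i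
    using bij_betwE[OF bij] A that by auto
  show ?thesis
    unfolding MI_ordering_def
  proof (intro conjI allI impI)
    fix i k assume "1 \<le> i \<and> i < k \<and> k \<le> t"
    then have ik: "1 \<le> i" "i < k" "k \<le> t" by auto
    have "\<Squnion>\<^bsub>L\<^esub>(a ` {i..k}) = \<Squnion>\<^bsub>K\<^esub>(a ` {i..k})"
      using ik mem by (intro sup) auto
    with joins[OF ik] show "\<Squnion>\<^bsub>L\<^esub>(a ` {i..k}) = a i \<squnion>\<^bsub>L\<^esub> a k"
      using ik mem by (simp add: join)
  next
    fix k assume "1 < k \<and> k < t"
    then have k: "1 < k" "k < t" by auto
    have X: "finite (a ` {1..k})" "a ` {1..k} \<subseteq> carrier K" "a ` {1..k} \<noteq> {}"
      using k mem by auto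
    \<comment> \<open>The meet is itself an argument of a binary join, and \<open>join\<close>
      applies only to elements of \<open>carrier K\<close>.\<close>
    have "\<Sqinter>\<^bsub>K\<^esub>(a ` {1..k}) \<in> carrier K"
      using X by (rule K.finite_inf_closed)
    with meets[OF k] show "(\<Sqinter>\<^bsub>L\<^esub>(a ` {1..k})) \<squnion>\<^bsub>L\<^esub> a (k + 1) = a k \<squnion>\<^bsub>L\<^esub> a (k + 1)"
      \<comment> \<open>Deleting \<open>One_nat_def\<close> keeps the index range in the form
        \<open>{1..k}\<close> that \<open>inf[OF X]\<close> rewrites.\<close>
      using k mem by (simp add: join inf[OF X] del: One_nat_def)
  qed (rule bij)
qed

lemma carrier_linear_sum [simp]: "carrier (linear_sum P Q) = carrier P \<union> carrier Q"
  by (simp add: linear_sum_def)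

lemma le_linear_sum_iff:
  "x \<sqsubseteq>\<^bsub>linear_sum P Q\<^esub> y \<longleftrightarrow>
     (x \<in> carrier P \<and> y \<in> carrier P \<and> x \<sqsubseteq>\<^bsub>P\<^esub> y) \<or>
     (x \<in> carrier Q \<and> y \<in> carrier Q \<and> x \<sqsubseteq>\<^bsub>Q\<^esub> y) \<or>
     (x \<in> carrier P \<and> y \<in> carrier Q)"
  by (simp add: linear_sum_def)

text \<open>A chain may step from \<open>P\<close> up into \<open>Q\<close>, but by disjointness
  never back. Hence antisymmetry reduces to a single summand, and a chain for transitivity either
  stays in one summand or crosses once.\<close>

lemma partial_order_linear_sum:
  assumes "partial_order P" and "partial_order Q" and disj: "carrier P \<inter> carrier Q = {}"
  shows "partial_order (linear_sum P Q)"
proof -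
  interpret P: partial_order P by fact
  interpret Q: partial_order Q by fact
  have eq: "x .=\<^bsub>linear_sum P Q\<^esub> y \<longleftrightarrow> x = y" for x y
    by (simp add: linear_sum_def)
  show ?thesis
  proof unfold_locales
    fix x y z
    assume "x \<sqsubseteq>\<^bsub>linear_sum P Q\<^esub> y" and "y \<sqsubseteq>\<^bsub>linear_sum P Q\<^esub> z"
    then show "x \<sqsubseteq>\<^bsub>linear_sum P Q\<^esub> z"
      using disj unfolding le_linear_sum_iff by (metis P.le_trans Q.le_trans disjoint_iff)
  next
    fix x y
    assume "x \<sqsubseteq>\<^bsub>linear_sum P Q\<^esub> y" and "y \<sqsubseteq>\<^bsub>linear_sum P Q\<^esub> x"
    then show "x .=\<^bsub>linear_sum P Q\<^esub> y"
      using disj unfolding le_linear_sum_iff eq by (metis P.le_antisym Q.le_antisym disjoint_iff)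
  qed (auto simp: eq le_linear_sum_iff fun_eq_iff)
qed

context
  fixes P :: "('a, 'b) gorder_scheme" and Q :: "('a, 'c) gorder_scheme"
  assumes disj: "carrier P \<inter> carrier Q = {}"
begin

text \<open>The new upper bounds are the elements of \<open>Q\<close>, and these all lie above
  \<open>s\<close>.\<close>

lemma least_linear_sum_left:
  assumes "X \<subseteq> carrier P" "X \<noteq> {}" "least P s (Upper P X)"
  shows "least (linear_sum P Q) s (Upper (linear_sum P Q) X)"
  using assms disj by (auto simp: least_def Upper_def le_linear_sum_iff)

text \<open>An element of \<open>X\<close> lies in \<open>Q\<close> and is below nothing in
  \<open>P\<close>, so a nonempty \<open>X\<close> gains no upper bounds in the sum.\<close>

lemma least_linear_sum_right:
  assumes "X \<subseteq> carrier Q" "X \<noteq> {}" "least Q s (Upper Q X)"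
  shows "least (linear_sum P Q) s (Upper (linear_sum P Q) X)"
  using assms disj by (auto simp: least_def Upper_def le_linear_sum_iff) blast+

text \<open>Dually, nothing in \<open>Q\<close> is below an element of \<open>X\<close>, so a
  nonempty \<open>X\<close> gains no lower bounds.\<close>

lemma greatest_linear_sum_left:
  assumes "X \<subseteq> carrier P" "X \<noteq> {}" "greatest P s (Lower P X)"
  shows "greatest (linear_sum P Q) s (Lower (linear_sum P Q) X)"
  using assms disj by (auto simp: greatest_def Lower_def le_linear_sum_iff) blast+

text \<open>The new lower bounds are the elements of \<open>P\<close>, and these all lie below
  \<open>s\<close>.\<close>

lemma greatest_linear_sum_right:
  assumes "X \<subseteq> carrier Q" "X \<noteq> {}" "greatest Q s (Lower Q X)"
  shows "greatest (linear_sum P Q) s (Lower (linear_sum P Q) X)"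
  using assms disj by (auto simp: greatest_def Lower_def le_linear_sum_iff)

lemma lattice_linear_sum:
  assumes "lattice P" and "lattice Q"
  shows "lattice (linear_sum P Q)"
proof -
  interpret P: lattice P by fact
  interpret Q: lattice Q by fact
  interpret S: partial_order "linear_sum P Q"
    by (intro partial_order_linear_sum P.partial_order_axioms Q.partial_order_axioms disj)
  \<comment> \<open>Here \<open>x\<close> is below \<open>y\<close>, so the pair has its larger
    member as join and its smaller one as meet.\<close>
  have mixed: "least (linear_sum P Q) y (Upper (linear_sum P Q) {x, y})"
    "greatest (linear_sum P Q) x (Lower (linear_sum P Q) {x, y})"
    if "x \<in> carrier P" "y \<in> carrier Q" for x y
    using that by (auto simp: least_def Upper_def greatest_def Lower_def le_linear_sum_iff)
  show ?thesis
  proof unfold_locales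
    fix x y
    assume xy: "x \<in> carrier (linear_sum P Q)" "y \<in> carrier (linear_sum P Q)"
    then consider "x \<in> carrier P" "y \<in> carrier P" | "x \<in> carrier Q" "y \<in> carrier Q"
      | "x \<in> carrier P" "y \<in> carrier Q" | "x \<in> carrier Q" "y \<in> carrier P"
      by auto
    note cases = this
    from cases show "\<exists>s. least (linear_sum P Q) s (Upper (linear_sum P Q) {x, y})"
    proof cases
      case 1
      with P.sup_of_two_exists least_linear_sum_left[of "{x, y}"] show ?thesis by blast
    next
      case 2
      with Q.sup_of_two_exists least_linear_sum_right[of "{x, y}"] show ?thesis by blast
    next
      case 3
      with mixed show ?thesis by blast
    next
      case 4
      with mixed(1)[of y x] show ?thesis by (auto simp: insert_commute)
    qed
    from cases show "\<exists>s. greatest (linear_sum P Q) s (Lower (linear_sum P Q) {x, y})"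
    proof cases
      case 1
      with P.inf_of_two_exists greatest_linear_sum_left[of "{x, y}"] show ?thesis by blast
    next
      case 2
      with Q.inf_of_two_exists greatest_linear_sum_right[of "{x, y}"] show ?thesis by blast
    next
      case 3
      with mixed show ?thesis by blast
    next
      case 4
      with mixed(2)[of y x] show ?thesis by (auto simp: insert_commute)
    qed
  qed
qed

lemma antichain_in_linear_sum:
  assumes "antichain_in (linear_sum P Q) A"
  shows "antichain_in P A \<or> antichain_in Q A"
proof -
  have sub: "x \<in> carrier P \<or> x \<in> carrier Q" if "x \<in> A" for x
    using assms that by (auto simp: antichain_in_def)
  have anti: "x = y" if "x \<in> A" "y \<in> A" "x \<sqsubseteq>\<^bsub>linear_sum P Q\<^esub> y" for x y
    using assms that by (simp add: antichain_in_def)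
  show ?thesis
  proof (cases "A \<subseteq> carrier P")
    case True
    then have "antichain_in P A"
      by (auto simp: antichain_in_def le_linear_sum_iff intro!: anti)
    then show ?thesis ..
  next
    case False
    then obtain y where y: "y \<in> A" "y \<in> carrier Q" using sub by blast
    \<comment> \<open>If \<open>x\<close> were in \<open>P\<close>, it would lie below
      \<open>y\<close>, so the antichain property would give \<open>x = y\<close>, which is in
      \<open>Q\<close>.\<close>
    have "x \<in> carrier Q" if "x \<in> A" for x
      using sub[OF that] anti[OF that y(1)] y(2) by (auto simp: le_linear_sum_iff)
    then have "antichain_in Q A"
      by (auto simp: antichain_in_def le_linear_sum_iff intro!: anti)
    then show ?thesis ..
  qed
qed

end

theorem theorem5p2:
  fixes P Q :: "'a gorder"
  assumes "MI_lattice P" and "finite (carrier P)"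
    and "MI_lattice Q" and "finite (carrier Q)"
    and "carrier P \<inter> carrier Q = {}"
  shows "MI_lattice (linear_sum P Q)"
proof -
  note disj = assms(5)
  have P: "lattice P" and Q: "lattice Q"
    using assms by (auto simp: MI_lattice_def)
  have S: "lattice (linear_sum P Q)"
    using disj P Q by (rule lattice_linear_sum)
  then interpret S: lattice "linear_sum P Q" .
  have "\<exists>t a. MI_ordering (linear_sum P Q) A t a" if "antichain_in (linear_sum P Q) A" for A
    using antichain_in_linear_sum[OF disj that]
  proof
    assume A: "antichain_in P A"
    then obtain t a where MI: "MI_ordering P A t a"
      using assms(1) unfolding MI_lattice_def by blast
    have "A \<subseteq> carrier P"
      using A by (simp add: antichain_in_def)
    \<comment> \<open>The listing obtained in \<open>P\<close> is kept unchanged; the two lemmas on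
      bounds in the left summand discharge the transfer conditions.\<close>
    then have "MI_ordering (linear_sum P Q) A t a"
      using MI by (intro MI_ordering_transfer[OF P S.partial_order_axioms]
          least_linear_sum_left[OF disj] greatest_linear_sum_left[OF disj])
    then show ?thesis by blast
  next
    assume A: "antichain_in Q A"
    then obtain t a where MI: "MI_ordering Q A t a"
      using assms(3) unfolding MI_lattice_def by blast
    have "A \<subseteq> carrier Q"
      using A by (simp add: antichain_in_def)
    then have "MI_ordering (linear_sum P Q) A t a"
      using MI by (intro MI_ordering_transfer[OF Q S.partial_order_axioms]
          least_linear_sum_right[OF disj] greatest_linear_sum_right[OF disj])
    then show ?thesis by blast
  qed
  with S show ?thesis
    unfolding MI_lattice_def by blast
qed

end
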